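(* $$\mathsf{WKL}\equiv_{\mathrm{sW}}\widehat{\mathsf{LLPO}}.$$
   Context: A multi-valued function $f:\subseteq X\rightrightarrows Y$ between represented spaces $(X,\delta_X),(Y,\delta_Y)$ (where $\delta_X:\subseteq\mathbb{N}^{\mathbb{N}}\to X$ is a surjective partial map, similarly $\delta_Y$) has domain $\{x: f(x)\neq\emptyset\}$. A realizer of $f$ is a partial $F:\subseteq\mathbb{N}^{\mathbb{N}}\to\mathbb{N}^{\mathbb{N}}$ such that $F(p)$ is defined and $\delta_YF(p)\in f(\delta_X(p))$ whenever $\delta_X(p)\in\mathrm{dom}(f)$. Strong Weihrauch reducibility: $f\leq_{\mathrm{sW}}g$ iff there are computable $H,K:\subseteq\mathbb{N}^{\mathbb{N}}\to\mathbb{N}^{\mathbb{N}}$ such that $H\circ G\circ K$ is a realizer of $f$ for every realizer $G$ of $g$. $f\equiv_{\mathrm{sW}}g$ iff $f\leq_{\mathrm{sW}}g$ and $g\leq_{\mathrm{sW}}f$. A binary tree is a set $T\subseteq\{0,1\}^*$ closed under prefixes. $\mathrm{Tr}$ is the set of binary trees, represented by $\delta_{\mathrm{Tr}}(p)=T:\iff\chi_T(w_n)=p(n)$ for all $n$, where $(w_n)_n$ is a standard bijective enumeration of $\{0,1\}^*$ and $\chi_T$ is the characteristic function of $T$. $[T]$ is the set of infinite paths of $T$, i.e. of $p\in\{0,1\}^{\mathbb{N}}$ all of whose finite prefixes lie in $T$. Weak König's Lemma is the multi-valued function $\mathsf{WKL}:\subseteq\mathrm{Tr}\rightrightarrows\{0,1\}^{\mathbb{N}}$,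 $T\mapsto[T]$, with domain the set of infinite binary trees. $\mathsf{LLPO}:\subseteq\mathbb{N}^{\mathbb{N}}\rightrightarrows\mathbb{N}$ has domain $\{p: p(k)\neq0\text{ for at most one }k\}$ and values in $\{0,1\}$, with $0\in\mathsf{LLPO}(p)\iff(\forall n)\,p(2n)=0$ and $1\in\mathsf{LLPO}(p)\iff(\forall n)\,p(2n+1)=0$. Its parallelization, regarded as a map $\widehat{\mathsf{LLPO}}:\subseteq\mathbb{N}^{\mathbb{N}}\rightrightarrows\mathbb{N}^{\mathbb{N}}$, is $\widehat{\mathsf{LLPO}}\langle p_0,p_1,\dots\rangle=\{q:(\forall k)\,q(k)\in\mathsf{LLPO}(p_k)\}$, defined when all $p_k\in\mathrm{dom}(\mathsf{LLPO})$, where $\langle p_0,p_1,\dots\rangle\langle k,n\rangle=p_k(n)$. $\mathbb{N}^{\mathbb{N}}$ and $\{0,1\}^{\mathbb{N}}$ are represented by the identity. *)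

theory Defs
  imports Main "HOL-Library.Nat_Bijection" "HOL-Library.Sublist"
begin

section \<open>Computable functions on Baire space\<close>

type_synonym baire = "nat \<Rightarrow> nat"

text \<open>
  Partial functionals that are partial recursive uniformly in an oracle: Kleene's schemes
  (zero, successor, projections, composition, primitive recursion, minimisation)
  together with the scheme that queries the oracle. Arities are not tracked: the arguments
  are passed as a list, and a functional that lacks an argument it needs is undefined.
\<close>

inductive oracle_recursive :: "(baire \<Rightarrow> nat list \<Rightarrow> nat option) \<Rightarrow> bool" where
  zero: "oracle_recursive (\<lambda>p xs. Some 0)"
| succ: "oracle_recursive (\<lambda>p xs. case xs of [] \<Rightarrow> None | x # _ \<Rightarrow> Some (Suc x))"
| query: "oracle_recursive (\<lambda>p xs. case xs of [] \<Rightarrow> None | x # _ \<Rightarrow> Some (p x))"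
| proj: "oracle_recursive (\<lambda>p xs. if i < length xs then Some (xs ! i) else None)"
| comp: "oracle_recursive f \<Longrightarrow> (\<And>g. g \<in> set gs \<Longrightarrow> oracle_recursive g) \<Longrightarrow>
    oracle_recursive (\<lambda>p xs. Option.bind (those (map (\<lambda>g. g p xs) gs)) (f p))"
| prim_rec: "oracle_recursive f \<Longrightarrow> oracle_recursive g \<Longrightarrow>
    oracle_recursive (\<lambda>p xs. case xs of [] \<Rightarrow> None
      | k # ys \<Rightarrow> rec_nat (f p ys) (\<lambda>m r. Option.bind r (\<lambda>v. g p (m # v # ys))) k)"
| minim: "oracle_recursive f \<Longrightarrow>
    oracle_recursive (\<lambda>p xs.
      if \<exists>m. f p (m # xs) = Some 0 \<and> (\<forall>j<m. \<exists>v>0. f p (j # xs) = Some v)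
      then Some (LEAST m. f p (m # xs) = Some 0) else None)"

text \<open>
  As usual for partial functions on Baire space, the machine has to produce \<open>F p\<close> for every
  \<open>p\<close> in the domain of \<open>F\<close>; its behaviour on other inputs is unrestricted.
\<close>

definition computable :: "(baire \<rightharpoonup> baire) \<Rightarrow> bool" where
  "computable F \<longleftrightarrow>
    (\<exists>\<Phi>. oracle_recursive \<Phi> \<and> (\<forall>p q. F p = Some q \<longrightarrow> (\<forall>n. \<Phi> p [n] = Some (q n))))"


section \<open>Realizers and strong Weihrauch reducibility\<close>

text \<open>
  A represented space is given by its representation, a partial map on Baire space; the
  underlying set is the range of that map. A multi-valued function is a set-valued function
  whose domain consists of the points with nonempty value.
\<close>

type_synonym 'a representation = "baire \<rightharpoonup> 'a"

definition mdom :: "('a \<Rightarrow> 'b set) \<Rightarrow> 'a set" where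
  "mdom f = {x. f x \<noteq> {}}"

definition realizer ::
  "'a representation \<Rightarrow> 'b representation \<Rightarrow> ('a \<Rightarrow> 'b set) \<Rightarrow> (baire \<rightharpoonup> baire) \<Rightarrow> bool" where
  "realizer \<delta>X \<delta>Y f F \<longleftrightarrow>
    (\<forall>p x. \<delta>X p = Some x \<and> x \<in> mdom f \<longrightarrow>
      (\<exists>q y. F p = Some q \<and> \<delta>Y q = Some y \<and> y \<in> f x))"

definition sW_reducible ::
  "'a representation \<Rightarrow> 'b representation \<Rightarrow> ('a \<Rightarrow> 'b set) \<Rightarrow>
   'c representation \<Rightarrow> 'd representation \<Rightarrow> ('c \<Rightarrow> 'd set) \<Rightarrow> bool" where
  "sW_reducible \<delta>X \<delta>Y f \<delta>U \<delta>V g \<longleftrightarrow>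
    (\<exists>H K. computable H \<and> computable K \<and>
      (\<forall>G. realizer \<delta>U \<delta>V g G \<longrightarrow> realizer \<delta>X \<delta>Y f (H \<circ>\<^sub>m G \<circ>\<^sub>m K)))"

definition sW_equivalent ::
  "'a representation \<Rightarrow> 'b representation \<Rightarrow> ('a \<Rightarrow> 'b set) \<Rightarrow>
   'c representation \<Rightarrow> 'd representation \<Rightarrow> ('c \<Rightarrow> 'd set) \<Rightarrow> bool" where
  "sW_equivalent \<delta>X \<delta>Y f \<delta>U \<delta>V g \<longleftrightarrow>
    sW_reducible \<delta>X \<delta>Y f \<delta>U \<delta>V g \<and> sW_reducible \<delta>U \<delta>V g \<delta>X \<delta>Y f"

definition delta_Baire :: "baire representation" where
  "delta_Baire p = Some p"

definition delta_Cantor :: "baire representation" where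
  "delta_Cantor p = (if range p \<subseteq> {0, 1} then Some p else None)"


section \<open>Binary trees and Weak Koenig's Lemma\<close>

definition binary_tree :: "nat list set \<Rightarrow> bool" where
  "binary_tree T \<longleftrightarrow> T \<subseteq> lists {0, 1} \<and> (\<forall>w\<in>T. \<forall>v. prefix v w \<longrightarrow> v \<in> T)"

text \<open>The length-lexicographic enumeration of binary words: [], 0, 1, 00, 01, 10, 11, 000, ...\<close>

fun word :: "nat \<Rightarrow> nat list" where
  "word 0 = []"
| "word (Suc n) = word (n div 2) @ [n mod 2]"

lemma bij_betw_word: "bij_betw word UNIV (lists {0, 1})"
proof -
  have inj: "word m = word n \<Longrightarrow> m = n" for m n
  proof (induction m arbitrary: n rule: word.induct)
    case 1
    then show ?case by (cases n) auto
  next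
    case (2 m)
    then obtain n' where n: "n = Suc n'" by (cases n) auto
    with "2.prems" have *: "word (m div 2) = word (n' div 2)" "m mod 2 = n' mod 2" by auto
    from "2.IH"[OF *(1)] *(2) have "m = n'" by (metis div_mult_mod_eq)
    with n show ?case by simp
  qed
  have in_lists: "word n \<in> lists {0, 1}" for n
    by (induction n rule: word.induct) auto
  have surj: "w \<in> lists {0, 1} \<Longrightarrow> w \<in> range word" for w
  proof (induction w rule: rev_induct)
    case Nil
    show ?case by (metis rangeI word.simps(1))
  next
    case (snoc b w)
    then obtain n where "w = word n" by auto
    moreover from snoc.prems have "b < 2" by auto
    ultimately have "w @ [b] = word (Suc (2 * n + b))" by simp
    then show ?case by (metis rangeI)
  qed
  show ?thesis
    unfolding bij_betw_def
  proof
    show "inj word" by (rule injI) (rule inj)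
    show "range word = lists {0, 1}" using in_lists surj by blast
  qed
qed

definition delta_Tr :: "nat list set representation" where
  "delta_Tr p =
    (if \<exists>T. binary_tree T \<and> (\<forall>n. of_bool (word n \<in> T) = p n)
     then Some (THE T. binary_tree T \<and> (\<forall>n. of_bool (word n \<in> T) = p n)) else None)"

lemma delta_Tr_eq_Some_iff:
  "delta_Tr p = Some T \<longleftrightarrow> binary_tree T \<and> (\<forall>n. of_bool (word n \<in> T) = p n)"
proof -
  let ?P = "\<lambda>T. binary_tree T \<and> (\<forall>n. of_bool (word n \<in> T) = p n)"
  have "T = T'" if T: "?P T" and T': "?P T'" for T T'
  proof -
    have iff: "word n \<in> T \<longleftrightarrow> word n \<in> T'" for n
    proof -
      have "(of_bool (word n \<in> T) :: nat) = of_bool (word n \<in> T')" using T T' by simp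
      then show ?thesis by (simp only: of_bool_eq_iff)
    qed
    have sub: "S \<subseteq> range word" if "binary_tree S" for S
      using that bij_betw_word unfolding binary_tree_def bij_betw_def by simp
    from sub[of T] sub[of T'] T T' iff show ?thesis by blast
  qed
  then have the: "(THE T. ?P T) = T'" if "?P T'" for T'
    using that by (intro the_equality)
  show ?thesis
  proof (cases "\<exists>T'. ?P T'")
    case True
    then obtain T' where T': "?P T'" by blast
    have "delta_Tr p = Some T'"
      unfolding delta_Tr_def if_P[OF True] the[OF T'] by (rule refl)
    moreover have "?P T \<longleftrightarrow> T' = T"
      using T' by (intro iffI) (erule the[of T, unfolded the[OF T']], erule subst)
    ultimately show ?thesis by simp
  next
    case False
    then have "delta_Tr p = None" unfolding delta_Tr_def by (rule if_not_P)
    moreover have "\<not> ?P T" using False by (rule contrapos_nn) (rule exI)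
    ultimately show ?thesis by (simp only: option.distinct simp_thms)
  qed
qed

lemma ran_delta_Tr: "ran delta_Tr = {T. binary_tree T}"
proof -
  have "\<exists>p. delta_Tr p = Some T" if "binary_tree T" for T
    by (rule exI[of _ "\<lambda>n. of_bool (word n \<in> T)"])
      (use that in \<open>simp add: delta_Tr_eq_Some_iff\<close>)
  then show ?thesis unfolding ran_def using delta_Tr_eq_Some_iff by blast
qed

definition paths :: "nat list set \<Rightarrow> baire set" where
  "paths T = {q. range q \<subseteq> {0, 1} \<and> (\<forall>n. map q [0..<n] \<in> T)}"

definition WKL :: "nat list set \<Rightarrow> baire set" where
  "WKL T = paths T"

lemma mdom_WKL:
  assumes T: "binary_tree T"
  shows "T \<in> mdom WKL \<longleftrightarrow> infinite T"
proof
  assume "T \<in> mdom WKL"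
  then obtain q where q: "\<And>n. map q [0..<n] \<in> T"
    unfolding mdom_def WKL_def paths_def by blast
  have "inj (\<lambda>n. map q [0..<n])"
    by (rule injI) (metis diff_zero length_map length_upt)
  moreover have "range (\<lambda>n. map q [0..<n]) \<subseteq> T" using q by auto
  ultimately show "infinite T" by (meson finite_subset finite_imageD infinite_UNIV_nat)
next
  assume inf: "infinite T"
  define I where "I w \<longleftrightarrow> infinite {u \<in> T. prefix w u}" for w
  have step: "\<exists>b\<in>{0, 1}. I (w @ [b])" if "I w" for w
  proof (rule ccontr)
    assume "\<not> ?thesis"
    then have fin: "finite {u \<in> T. prefix (w @ [0]) u}" "finite {u \<in> T. prefix (w @ [1]) u}"
      unfolding I_def by auto
    have "{u \<in> T. prefix w u} \<subseteq>
        {w} \<union> {u \<in> T. prefix (w @ [0]) u} \<union> {u \<in> T. prefix (w @ [1]) u}"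
    proof
      fix u assume u: "u \<in> {u \<in> T. prefix w u}"
      then obtain v where v: "u = w @ v" by (auto simp: prefix_def)
      show "u \<in> {w} \<union> {u \<in> T. prefix (w @ [0]) u} \<union> {u \<in> T. prefix (w @ [1]) u}"
      proof (cases v)
        case Nil
        with v show ?thesis by simp
      next
        case (Cons b v')
        from u T v Cons have "b \<in> {0, 1}" unfolding binary_tree_def by auto
        with u v Cons show ?thesis by auto
      qed
    qed
    with fin have "finite {u \<in> T. prefix w u}" by (simp add: finite_subset)
    with that show False unfolding I_def by simp
  qed
  define c where "c w = (SOME b. b \<in> {0, 1} \<and> I (w @ [b]))" for w
  have c: "c w \<in> {0, 1} \<and> I (w @ [c w])" if "I w" for w
    unfolding c_def by (rule someI_ex) (use step[OF that] in blast)
  define W where "W = rec_nat [] (\<lambda>_ w. w @ [c w])"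
  have W0: "W 0 = []" and WS: "W (Suc n) = W n @ [c (W n)]" for n by (simp_all add: W_def)
  define q where "q n = c (W n)" for n
  have Wq: "W n = map q [0..<n]" for n by (induction n) (simp_all add: W0 WS q_def)
  have IW: "I (W n)" for n
    by (induction n) (use inf c in \<open>auto simp: W0 WS I_def\<close>)
  have "W n \<in> T" for n
  proof -
    from IW[of n] have "{u \<in> T. prefix (W n) u} \<noteq> {}" unfolding I_def by (metis finite.emptyI)
    with T show ?thesis unfolding binary_tree_def by auto
  qed
  moreover have "range q \<subseteq> {0, 1}" unfolding q_def
    by (intro image_subsetI) (rule conjunct1[OF c[OF IW]])
  ultimately have "q \<in> WKL T" unfolding WKL_def paths_def using Wq by simp
  then show "T \<in> mdom WKL" unfolding mdom_def by auto
qed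


section \<open>LLPO and parallelization\<close>

definition LLPO :: "baire \<Rightarrow> nat set" where
  "LLPO p =
    (if \<forall>k l. p k \<noteq> 0 \<and> p l \<noteq> 0 \<longrightarrow> k = l
     then {i. i = 0 \<and> (\<forall>n. p (2 * n) = 0) \<or> i = 1 \<and> (\<forall>n. p (2 * n + 1) = 0)} else {})"

lemma mdom_LLPO: "p \<in> mdom LLPO \<longleftrightarrow> (\<forall>k l. p k \<noteq> 0 \<and> p l \<noteq> 0 \<longrightarrow> k = l)"
proof -
  have "(\<forall>n. p (2 * n) = 0) \<or> (\<forall>n. p (2 * n + 1) = 0)"
    if "\<forall>k l. p k \<noteq> 0 \<and> p l \<noteq> 0 \<longrightarrow> k = l"
  proof (rule ccontr)
    assume "\<not> ?thesis"
    then obtain m n where "p (2 * m) \<noteq> 0" "p (2 * n + 1) \<noteq> 0" by blast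
    with that have "2 * m = 2 * n + 1" by blast
    then show False by presburger
  qed
  then show ?thesis unfolding mdom_def LLPO_def by auto
qed

text \<open>The sequence coded by \<open>p\<close> has \<open>\<lambda>n. p \<langle>k, n\<rangle>\<close> as its \<open>k\<close>-th member, with Cantor pairing.\<close>

definition parallelization :: "(baire \<Rightarrow> nat set) \<Rightarrow> baire \<Rightarrow> baire set" where
  "parallelization f p = {q. \<forall>k. q k \<in> f (\<lambda>n. p (prod_encode (k, n)))}"

lemma mdom_parallelization:
  "p \<in> mdom (parallelization f) \<longleftrightarrow> (\<forall>k. (\<lambda>n. p (prod_encode (k, n))) \<in> mdom f)"
proof -
  have "(\<exists>q. \<forall>k. q k \<in> f (\<lambda>n. p (prod_encode (k, n)))) \<longleftrightarrow>
      (\<forall>k. \<exists>i. i \<in> f (\<lambda>n. p (prod_encode (k, n))))"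
    using choice by metis
  then show ?thesis unfolding mdom_def parallelization_def by blast
qed

end

theory Submission
  imports Defs
begin

text \<open>
  Both reductions rest on the same picture of \<open>LLPO\<close>: an instance is a race between two
  claims, at most one of which is ever refuted, and a solution names a claim that is not refuted.

  To find a path through an infinite binary tree, ask at every node \<open>w\<close>, in parallel, which of
  the two subtrees below \<open>w\<close> is infinite. That the subtree below \<open>w @ [b]\<close> is finite is seen at
  some finite level \<open>n\<close>; the instance of \<open>LLPO\<close> belonging to \<open>w\<close> then refutes \<open>b\<close> at stage \<open>n\<close>,
  provided that the sibling still has descendants at level \<open>n\<close>. The proviso guarantees that only
  one of the two claims is refuted, for every \<open>w\<close>, and it holds automatically if the subtree
  below \<open>w\<close> is infinite. Starting at the root and following the answers therefore never leaves the
  infinite part of the tree (\<open>child_infinite\<close>). The answers alone determine the path, so that the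
  reduction is strong.

  Conversely, the solutions of a sequence of instances of \<open>LLPO\<close> form a closed set and so are
  the paths of a tree: a word is kept as long as none of its letters has been refuted by the
  stage given by its length (\<open>paths_answer_tree\<close>).

  What remains is to see that the two translations are computable. Words are handled through
  their indices: if \<open>v = i + 1\<close>, then the binary digits of \<open>v\<close> after the leading one spell
  \<open>word i\<close>. Consequently the children of the node with number \<open>v\<close> have the numbers \<open>2 * v\<close> and
  \<open>2 * v + 1\<close>, and its descendants \<open>n\<close> levels below have the numbers \<open>v * 2 ^ n + j\<close> with
  \<open>j < 2 ^ n\<close>. Everything becomes bounded quantification over arithmetic expressions, which is
  primitive recursive in the oracle.
\<close>


section \<open>A calculus of total functionals recursive in an oracle\<close>

text \<open>
  Arguments live in an environment of fixed length \<open>n\<close>; outside that length nothing is claimed.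
  Fixing the length hides the partiality of the underlying schemes. The binding
  rules below put the bound variable in front of the environment, so that it is \<open>hd xs\<close> in the
  premise while the old environment is \<open>tl xs\<close>.
\<close>

definition total_recursive :: "nat \<Rightarrow> (baire \<Rightarrow> nat list \<Rightarrow> nat) \<Rightarrow> bool" where
  "total_recursive n f \<longleftrightarrow>
    (\<exists>\<Phi>. oracle_recursive \<Phi> \<and> (\<forall>p xs. length xs = n \<longrightarrow> \<Phi> p xs = Some (f p xs)))"

lemma total_recursiveI:
  assumes "oracle_recursive \<Phi>" "\<And>p xs. length xs = n \<Longrightarrow> \<Phi> p xs = Some (f p xs)"
  shows "total_recursive n f"
  using assms unfolding total_recursive_def by blast

lemma total_recursiveE:
  assumes "total_recursive n f"
  obtains \<Phi> where "oracle_recursive \<Phi>" "\<And>p xs. length xs = n \<Longrightarrow> \<Phi> p xs = Some (f p xs)"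
  using assms unfolding total_recursive_def by blast

lemma total_recursive_cong:
  assumes "total_recursive n f" "\<And>p xs. length xs = n \<Longrightarrow> f p xs = g p xs"
  shows "total_recursive n g"
  using assms unfolding total_recursive_def by metis

lemma computable_if_total_recursive:
  assumes "total_recursive 1 (\<lambda>p xs. F p (xs ! 0))"
  shows "computable (\<lambda>p. Some (F p))"
proof -
  from assms obtain \<Phi> where "oracle_recursive \<Phi>"
      and "\<And>p xs. length xs = 1 \<Longrightarrow> \<Phi> p xs = Some (F p (xs ! 0))"
    by (rule total_recursiveE) blast
  then show ?thesis unfolding computable_def by (intro exI[of _ \<Phi>]) simp
qed

lemma total_recursive_nth: "i < n \<Longrightarrow> total_recursive n (\<lambda>p xs. xs ! i)"
  by (rule total_recursiveI[OF oracle_recursive.proj[of i]]) simp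

lemma total_recursive_subst:
  assumes f: "total_recursive m f" and g: "\<And>i. i < m \<Longrightarrow> total_recursive n (g i)"
  shows "total_recursive n (\<lambda>p xs. f p (map (\<lambda>i. g i p xs) [0..<m]))"
proof -
  from f obtain \<Phi> where \<Phi>: "oracle_recursive \<Phi>"
      "\<And>p xs. length xs = m \<Longrightarrow> \<Phi> p xs = Some (f p xs)"
    by (rule total_recursiveE) blast
  from g have "\<forall>i. \<exists>\<Psi>. i < m \<longrightarrow> oracle_recursive \<Psi> \<and>
      (\<forall>p xs. length xs = n \<longrightarrow> \<Psi> p xs = Some (g i p xs))"
    unfolding total_recursive_def by blast
  then obtain \<Psi> where \<Psi>: "\<And>i. i < m \<Longrightarrow> oracle_recursive (\<Psi> i)"
      "\<And>i p xs. i < m \<Longrightarrow> length xs = n \<Longrightarrow> \<Psi> i p xs = Some (g i p xs)"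
    by metis
  have those: "those (map (\<lambda>i. \<Psi> i p xs) is) = Some (map (\<lambda>i. g i p xs) is)"
    if "length xs = n" "set is \<subseteq> {..<m}" for p xs "is"
    using that by (induction "is") (auto simp: \<Psi>)
  show ?thesis
  proof (rule total_recursiveI)
    show "oracle_recursive
        (\<lambda>p xs. Option.bind (those (map (\<lambda>\<psi>. \<psi> p xs) (map \<Psi> [0..<m]))) (\<Phi> p))"
      by (rule oracle_recursive.comp) (use \<Phi> \<Psi> in auto)
    show "Option.bind (those (map (\<lambda>\<psi>. \<psi> p xs) (map \<Psi> [0..<m]))) (\<Phi> p) =
        Some (f p (map (\<lambda>i. g i p xs) [0..<m]))" if "length xs = n" for p xs
      using that those[of xs "[0..<m]" p] by (simp add: comp_def \<Phi> atLeast0LessThan)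
  qed
qed

lemma total_recursive_subst1:
  assumes "total_recursive 1 (\<lambda>p xs. f p (xs ! 0))" "total_recursive n g"
  shows "total_recursive n (\<lambda>p xs. f p (g p xs))"
  using total_recursive_subst[OF assms(1), of n "\<lambda>i. g"] assms(2) by simp

lemma total_recursive_Suc:
  assumes "total_recursive n f"
  shows "total_recursive n (\<lambda>p xs. Suc (f p xs))"
proof -
  have "total_recursive 1 (\<lambda>p xs. Suc (xs ! 0))"
    by (rule total_recursiveI[OF oracle_recursive.succ]) (auto split: list.split)
  from total_recursive_subst1[OF this assms] show ?thesis .
qed

lemma total_recursive_oracle:
  assumes "total_recursive n f"
  shows "total_recursive n (\<lambda>p xs. p (f p xs))"
proof -
  have "total_recursive 1 (\<lambda>p xs. p (xs ! 0))"
    by (rule total_recursiveI[OF oracle_recursive.query]) (auto split: list.split)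
  from total_recursive_subst1[OF this assms] show ?thesis .
qed

lemma total_recursive_const: "total_recursive n (\<lambda>p xs. c)"
proof (induction c)
  case 0
  show ?case by (rule total_recursiveI[OF oracle_recursive.zero]) simp
next
  case (Suc c)
  then show ?case by (rule total_recursive_Suc)
qed

lemma total_recursive_nth_tl: "Suc i < n \<Longrightarrow> total_recursive n (\<lambda>p xs. tl xs ! i)"
  by (rule total_recursive_cong[OF total_recursive_nth[of "Suc i"]]) (auto simp: nth_tl)

lemma total_recursive_nth_tl_tl: "i + 2 < n \<Longrightarrow> total_recursive n (\<lambda>p xs. tl (tl xs) ! i)"
  by (rule total_recursive_cong[OF total_recursive_nth[of "i + 2"]]) (auto simp: nth_tl)

lemma total_recursive_hd: "0 < n \<Longrightarrow> total_recursive n (\<lambda>p xs. hd xs)"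
  by (rule total_recursive_cong[OF total_recursive_nth[of 0]]) (auto simp: hd_conv_nth)

lemma total_recursive_hd_tl: "1 < n \<Longrightarrow> total_recursive n (\<lambda>p xs. hd (tl xs))"
  by (rule total_recursive_cong[OF total_recursive_nth_tl[of 0]])
    (auto simp: hd_conv_nth simp flip: length_greater_0_conv)

lemma total_recursive_weaken:
  assumes "total_recursive n f"
  shows "total_recursive (Suc n) (\<lambda>p xs. f p (tl xs))"
proof (rule total_recursive_cong)
  show "total_recursive (Suc n) (\<lambda>p xs. f p (map (\<lambda>i. tl xs ! i) [0..<n]))"
    by (intro total_recursive_subst[OF assms] total_recursive_nth_tl) simp
  show "f p (map (\<lambda>i. tl xs ! i) [0..<n]) = f p (tl xs)" if "length xs = Suc n" for p xs
    using that map_nth[of "tl xs"] by simp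
qed

text \<open>
  Primitive recursion binds the counter and the previous value, a bounded sum only the counter;
  this inserts the dummy second variable.
\<close>

lemma total_recursive_weaken_snd:
  assumes "total_recursive (Suc n) (\<lambda>p xs. f p (hd xs) (tl xs))"
  shows "total_recursive (Suc (Suc n)) (\<lambda>p xs. f p (hd xs) (tl (tl xs)))"
proof (rule total_recursive_cong)
  let ?g = "\<lambda>i xs. if i = 0 then hd xs else tl xs ! i"
  let ?ys = "\<lambda>xs. map (\<lambda>i. ?g i xs) [0..<Suc n]"
  have "total_recursive (Suc (Suc n)) (\<lambda>p. ?g i)" if "i < Suc n" for i
    using that by (cases "i = 0") (simp_all add: total_recursive_hd total_recursive_nth_tl)
  from total_recursive_subst[OF assms this]
  show "total_recursive (Suc (Suc n)) (\<lambda>p xs. f p (hd (?ys xs)) (tl (?ys xs)))" .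
  fix p and xs :: "nat list" assume len: "length xs = Suc (Suc n)"
  have "tl (?ys xs) = map (\<lambda>i. tl xs ! Suc i) [0..<n]"
    by (subst upt_conv_Cons) (auto simp: map_Suc_upt[symmetric] simp del: upt_Suc)
  also have "\<dots> = tl (tl xs)" using len by (intro nth_equalityI) (auto simp: nth_tl)
  finally show "f p (hd (?ys xs)) (tl (?ys xs)) = f p (hd xs) (tl (tl xs))"
    by (subst (1) upt_conv_Cons) (simp_all del: upt_Suc)
qed

lemma total_recursive_rec_nat:
  assumes f: "total_recursive n f"
    and g: "total_recursive (Suc (Suc n)) (\<lambda>p xs. g p (hd xs) (hd (tl xs)) (tl (tl xs)))"
    and c: "total_recursive n c"
  shows "total_recursive n (\<lambda>p xs. rec_nat (f p xs) (\<lambda>m r. g p m r xs) (c p xs))"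
proof -
  from f obtain \<Phi> where \<Phi>: "oracle_recursive \<Phi>"
      "\<And>p xs. length xs = n \<Longrightarrow> \<Phi> p xs = Some (f p xs)"
    by (rule total_recursiveE) blast
  from g obtain \<Psi> where \<Psi>: "oracle_recursive \<Psi>" "\<And>p xs. length xs = Suc (Suc n) \<Longrightarrow>
      \<Psi> p xs = Some (g p (hd xs) (hd (tl xs)) (tl (tl xs)))"
    by (rule total_recursiveE) blast
  have rec: "rec_nat (\<Phi> p ys) (\<lambda>m r. Option.bind r (\<lambda>v. \<Psi> p (m # v # ys))) k =
      Some (rec_nat (f p ys) (\<lambda>m r. g p m r ys) k)" if "length ys = n" for p ys k
    using that by (induction k) (simp_all add: \<Phi> \<Psi>)
  have *: "total_recursive (Suc n)
      (\<lambda>p xs. rec_nat (f p (tl xs)) (\<lambda>m r. g p m r (tl xs)) (hd xs))"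
    by (rule total_recursiveI[OF oracle_recursive.prim_rec[OF \<Phi>(1) \<Psi>(1)]])
      (auto simp: rec split: list.split)
  \<comment> \<open>The scheme recurses on the first argument; substituting \<open>c\<close> for it gives an arbitrary count.\<close>
  let ?g = "\<lambda>i p xs. if i = 0 then c p xs else xs ! (i - 1)"
  let ?ys = "\<lambda>p xs. map (\<lambda>i. ?g i p xs) [0..<Suc n]"
  have ys: "?ys p xs = c p xs # xs" if "length xs = n" for p xs
    by (rule nth_equalityI) (use that in \<open>auto simp: nth_Cons' simp del: upt_Suc\<close>)
  show ?thesis
  proof (rule total_recursive_cong)
    have "total_recursive n (?g i)" if "i < Suc n" for i
      using that c by (cases "i = 0") (auto simp: total_recursive_nth)
    from total_recursive_subst[OF * this]
    show "total_recursive n (\<lambda>p xs. rec_nat (f p (tl (?ys p xs)))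
        (\<lambda>m r. g p m r (tl (?ys p xs))) (hd (?ys p xs)))" .
  qed (simp only: ys list.sel)
qed

lemmas total_recursive_basic =
  total_recursive_nth total_recursive_nth_tl total_recursive_nth_tl_tl
  total_recursive_hd total_recursive_hd_tl
  total_recursive_const total_recursive_Suc total_recursive_oracle


subsection \<open>Arithmetic\<close>

lemma total_recursive_add:
  assumes "total_recursive n f" "total_recursive n g"
  shows "total_recursive n (\<lambda>p xs. f p xs + g p xs)"
proof (rule total_recursive_cong)
  show "total_recursive n (\<lambda>p xs. rec_nat (f p xs) (\<lambda>_ r. Suc r) (g p xs))"
    by (intro total_recursive_rec_nat total_recursive_basic assms) simp
  have "rec_nat a (\<lambda>_ r. Suc r) b = a + b" for a b by (induction b) simp_all
  then show "rec_nat (f p xs) (\<lambda>_ r. Suc r) (g p xs) = f p xs + g p xs" for p xs .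
qed

lemma total_recursive_diff:
  assumes "total_recursive n f" "total_recursive n g"
  shows "total_recursive n (\<lambda>p xs. f p xs - g p xs)"
proof (rule total_recursive_cong)
  have pred: "total_recursive m (\<lambda>p xs. rec_nat 0 (\<lambda>m _. m) (h p xs))"
    if "total_recursive m h" for m h
    by (intro total_recursive_rec_nat total_recursive_basic that) simp
  show "total_recursive n (\<lambda>p xs. rec_nat (f p xs) (\<lambda>_ r. rec_nat 0 (\<lambda>m _. m) r) (g p xs))"
    by (intro total_recursive_rec_nat pred total_recursive_basic assms) simp
  have "rec_nat 0 (\<lambda>m _. m) k = k - 1" for k :: nat by (cases k) simp_all
  then have "rec_nat a (\<lambda>_ r. rec_nat 0 (\<lambda>m _. m) r) b = a - b" for a b :: nat
    by (induction b) simp_all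
  then show "rec_nat (f p xs) (\<lambda>_ r. rec_nat 0 (\<lambda>m _. m) r) (g p xs) = f p xs - g p xs" for p xs .
qed

lemma total_recursive_sum:
  assumes "total_recursive (Suc n) (\<lambda>p xs. f p (hd xs) (tl xs))" "total_recursive n c"
  shows "total_recursive n (\<lambda>p xs. \<Sum>j<c p xs. f p j xs)"
proof (rule total_recursive_cong)
  have "total_recursive (Suc (Suc n)) (\<lambda>p xs. f p (hd xs) (tl (tl xs)))"
    by (rule total_recursive_weaken_snd) (rule assms)
  then show "total_recursive n (\<lambda>p xs. rec_nat 0 (\<lambda>j r. r + f p j xs) (c p xs))"
    by (intro total_recursive_rec_nat total_recursive_add total_recursive_basic assms) simp_all
  have "rec_nat 0 (\<lambda>j r. r + f p j xs) k = (\<Sum>j<k. f p j xs)" for p xs k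
    by (induction k) simp_all
  then show "rec_nat 0 (\<lambda>j r. r + f p j xs) (c p xs) = (\<Sum>j<c p xs. f p j xs)" for p xs .
qed

lemma total_recursive_mult:
  assumes "total_recursive n f" "total_recursive n g"
  shows "total_recursive n (\<lambda>p xs. f p xs * g p xs)"
  by (rule total_recursive_cong[OF total_recursive_sum[OF total_recursive_weaken[OF assms(1)] assms(2)]])
    simp

lemma total_recursive_power2:
  assumes "total_recursive n f"
  shows "total_recursive n (\<lambda>p xs. 2 ^ f p xs)"
proof (rule total_recursive_cong)
  show "total_recursive n (\<lambda>p xs. rec_nat 1 (\<lambda>_ r. r + r) (f p xs))"
    by (intro total_recursive_rec_nat total_recursive_add total_recursive_basic assms) simp_all
  have "rec_nat 1 (\<lambda>_ r. r + r) k = (2::nat) ^ k" for k by (induction k) simp_all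
  then show "rec_nat 1 (\<lambda>_ r. r + r) (f p xs) = (2::nat) ^ f p xs" for p xs .
qed


subsection \<open>Decidable predicates\<close>

lemma total_recursive_eq_0:
  assumes "total_recursive n f"
  shows "total_recursive n (\<lambda>p xs. of_bool (f p xs = 0))"
  by (rule total_recursive_cong[OF total_recursive_diff[OF total_recursive_const[of n 1] assms]])
    simp

lemma total_recursive_not:
  assumes "total_recursive n (\<lambda>p xs. of_bool (P p xs))"
  shows "total_recursive n (\<lambda>p xs. of_bool (\<not> P p xs))"
  by (rule total_recursive_cong[OF total_recursive_eq_0[OF assms]]) simp

lemma total_recursive_conj:
  assumes "total_recursive n (\<lambda>p xs. of_bool (P p xs))" "total_recursive n (\<lambda>p xs. of_bool (Q p xs))"
  shows "total_recursive n (\<lambda>p xs. of_bool (P p xs \<and> Q p xs))"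
  by (rule total_recursive_cong[OF total_recursive_mult[OF assms]]) simp

lemma total_recursive_le:
  assumes "total_recursive n f" "total_recursive n g"
  shows "total_recursive n (\<lambda>p xs. of_bool (f p xs \<le> g p xs))"
  by (rule total_recursive_cong[OF total_recursive_eq_0[OF total_recursive_diff[OF assms]]]) simp

lemma total_recursive_eq:
  assumes "total_recursive n f" "total_recursive n g"
  shows "total_recursive n (\<lambda>p xs. of_bool (f p xs = g p xs))"
proof (rule total_recursive_cong)
  show "total_recursive n (\<lambda>p xs. of_bool (f p xs \<le> g p xs \<and> g p xs \<le> f p xs))"
    by (intro total_recursive_conj total_recursive_le assms)
qed auto

lemma total_recursive_all_less:
  assumes "total_recursive (Suc n) (\<lambda>p xs. of_bool (P p (hd xs) (tl xs)))" "total_recursive n c"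
  shows "total_recursive n (\<lambda>p xs. of_bool (\<forall>j<c p xs. P p j xs))"
proof (rule total_recursive_cong)
  have "total_recursive (Suc n) (\<lambda>p xs. of_bool (\<not> P p (hd xs) (tl xs)))"
    by (intro total_recursive_not assms)
  then show "total_recursive n (\<lambda>p xs. of_bool ((\<Sum>j<c p xs. of_bool (\<not> P p j xs)) = (0::nat)))"
    by (intro total_recursive_eq_0 total_recursive_sum assms(2))
qed auto

lemmas total_recursive_intros =
  total_recursive_basic total_recursive_add total_recursive_diff total_recursive_mult
  total_recursive_sum total_recursive_power2 total_recursive_not total_recursive_conj
  total_recursive_le total_recursive_eq total_recursive_all_less

lemma total_recursive_div_power2:
  assumes "total_recursive n f" "total_recursive n g"
  shows "total_recursive n (\<lambda>p xs. f p xs div 2 ^ g p xs)"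
proof (rule total_recursive_cong)
  show "total_recursive n (\<lambda>p xs. \<Sum>j<f p xs. of_bool (Suc j * 2 ^ g p xs \<le> f p xs))"
    by (intro total_recursive_intros total_recursive_weaken assms) simp
  show "(\<Sum>j<f p xs. of_bool (Suc j * 2 ^ g p xs \<le> f p xs)) = f p xs div 2 ^ g p xs" for p xs
  proof -
    let ?d = "f p xs div 2 ^ g p xs"
    have "Suc j * 2 ^ g p xs \<le> f p xs \<longleftrightarrow> j < ?d" for j
      using less_eq_div_iff_mult_less_eq[of "2 ^ g p xs" "Suc j" "f p xs"] by (simp add: Suc_le_eq)
    moreover have "{..<f p xs} \<inter> {j. j < ?d} = {..<?d}"
      by (auto intro: less_le_trans[OF _ div_le_dividend])
    ultimately show ?thesis by (simp add: sum.If_cases of_bool_def)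
  qed
qed

lemma total_recursive_div2:
  assumes "total_recursive n f"
  shows "total_recursive n (\<lambda>p xs. f p xs div 2)"
  using total_recursive_div_power2[OF assms total_recursive_const[of n 1]] by simp

lemma total_recursive_mod2:
  assumes "total_recursive n f"
  shows "total_recursive n (\<lambda>p xs. f p xs mod 2)"
proof (rule total_recursive_cong)
  show "total_recursive n (\<lambda>p xs. f p xs - 2 * (f p xs div 2))"
    by (intro total_recursive_intros total_recursive_div2 assms)
qed (simp add: minus_mult_div_eq_mod)


subsection \<open>Pairs and binary words\<close>

lemma total_recursive_prod_encode:
  assumes "total_recursive n f" "total_recursive n g"
  shows "total_recursive n (\<lambda>p xs. prod_encode (f p xs, g p xs))"
proof (rule total_recursive_cong)
  show "total_recursive n (\<lambda>p xs. (\<Sum>j<f p xs + g p xs. Suc j) + f p xs)"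
    by (intro total_recursive_intros assms) simp_all
  have "(\<Sum>j<k. Suc j) = triangle k" for k by (induction k) simp_all
  then show "(\<Sum>j<f p xs + g p xs. Suc j) + f p xs = prod_encode (f p xs, g p xs)" for p xs
    by (simp add: prod_encode_def)
qed

text \<open>
  Both components of a pair are bounded by its code, so they can be found by exhaustive search;
  the sum has a single nonzero term.
\<close>

lemma sum_prod_decode:
  fixes h :: "nat \<Rightarrow> nat \<Rightarrow> nat"
  shows "(\<Sum>a<Suc x. \<Sum>b<Suc x. of_bool (prod_encode (a, b) = x) * h a b) =
    h (fst (prod_decode x)) (snd (prod_decode x))"
proof -
  obtain k m where km: "prod_decode x = (k, m)" by fastforce
  then have x: "x = prod_encode (k, m)" by (metis prod_decode_inverse)
  have "(\<Sum>a<Suc x. \<Sum>b<Suc x. of_bool (prod_encode (a, b) = x) * h a b) =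
      (\<Sum>a<Suc x. \<Sum>b<Suc x. if b = m then if a = k then h k m else 0 else 0)"
    by (intro sum.cong refl) (auto simp: x)
  also have "\<dots> = (\<Sum>a<Suc x. if a = k then h k m else 0)"
    using le_prod_encode_2[of m k] by (simp add: x sum.delta del: sum.lessThan_Suc)
  also have "\<dots> = h k m"
    using le_prod_encode_1[of k m] by (simp add: x sum.delta del: sum.lessThan_Suc)
  finally show ?thesis by (simp add: km)
qed

lemma total_recursive_prod_decode:
  assumes "total_recursive n f"
  shows "total_recursive n (\<lambda>p xs. fst (prod_decode (f p xs)))"
    and "total_recursive n (\<lambda>p xs. snd (prod_decode (f p xs)))"
proof -
  have f': "total_recursive (Suc n) (\<lambda>p xs. f p (tl xs))"
    by (rule total_recursive_weaken) (rule assms)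
  have f'': "total_recursive (Suc (Suc n)) (\<lambda>p xs. f p (tl (tl xs)))"
    by (rule total_recursive_weaken) (rule f')
  have "total_recursive n (\<lambda>p xs. \<Sum>a<Suc (f p xs). \<Sum>b<Suc (f p xs).
      of_bool (prod_encode (a, b) = f p xs) * a)"
    by (intro total_recursive_intros total_recursive_prod_encode assms f' f'') simp_all
  then show "total_recursive n (\<lambda>p xs. fst (prod_decode (f p xs)))"
    by (rule total_recursive_cong) (simp only: sum_prod_decode)
  have "total_recursive n (\<lambda>p xs. \<Sum>a<Suc (f p xs). \<Sum>b<Suc (f p xs).
      of_bool (prod_encode (a, b) = f p xs) * b)"
    by (intro total_recursive_intros total_recursive_prod_encode assms f' f'') simp_all
  then show "total_recursive n (\<lambda>p xs. snd (prod_decode (f p xs)))"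
    by (rule total_recursive_cong) (simp only: sum_prod_decode)
qed

lemma length_word_bounds: "2 ^ length (word i) \<le> Suc i" "Suc i < 2 ^ Suc (length (word i))"
  by (induction i rule: word.induct) auto

lemma length_word_eq_sum: "length (word i) = (\<Sum>j<i. of_bool (2 ^ Suc j \<le> Suc i))"
proof -
  let ?l = "length (word i)"
  have iff: "2 ^ Suc j \<le> Suc i \<longleftrightarrow> j < ?l" for j
  proof
    assume "2 ^ Suc j \<le> Suc i"
    also note length_word_bounds(2)
    finally show "j < ?l" by (simp del: power_Suc)
  next
    assume "j < ?l"
    then have "(2::nat) ^ Suc j \<le> 2 ^ ?l" by (intro power_increasing) auto
    also note length_word_bounds(1)
    finally show "2 ^ Suc j \<le> Suc i" .
  qed
  have "?l < 2 ^ ?l" by simp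
  also note length_word_bounds(1)
  finally have "{..<i} \<inter> {j. j < ?l} = {..<?l}" by auto
  then show ?thesis by (simp add: iff sum.If_cases of_bool_def del: power_Suc)
qed

lemma nth_word:
  "k < length (word i) \<Longrightarrow> word i ! k = Suc i div 2 ^ (length (word i) - Suc k) mod 2"
proof (induction i rule: word.induct)
  case 1
  then show ?case by simp
next
  case (2 i)
  let ?l = "length (word (i div 2))"
  show ?case
  proof (cases "k < ?l")
    case True
    then have "length (word (Suc i)) - Suc k = Suc (?l - Suc k)" by simp
    then show ?thesis using 2 True by (simp add: nth_append div_mult2_eq)
  next
    case False
    with "2.prems" have "k = ?l" by simp
    then show ?thesis by (simp add: nth_append)
  qed
qed

lemma total_recursive_length_word:
  assumes "total_recursive n f"
  shows "total_recursive n (\<lambda>p xs. length (word (f p xs)))"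
proof (rule total_recursive_cong)
  show "total_recursive n (\<lambda>p xs. \<Sum>j<f p xs. of_bool (2 ^ Suc j \<le> Suc (f p xs)))"
    by (intro total_recursive_intros total_recursive_weaken assms) simp
qed (simp only: length_word_eq_sum)


section \<open>From trees to instances of LLPO\<close>

text \<open>
  The argument \<open>v\<close> is the number of a node, which is one more than its index in the enumeration
  \<open>word\<close>; the root has number 1.
\<close>

definition dead :: "baire \<Rightarrow> nat \<Rightarrow> nat \<Rightarrow> bool" where
  "dead p v n \<longleftrightarrow> (\<forall>j<2 ^ n. p (v * 2 ^ n + j - 1) = 0)"

text \<open>
  Stage \<open>2 * n + b\<close> refutes \<open>b\<close> at node \<open>v\<close>. Only the first level at which the child \<open>b\<close>
  is dead counts, since an instance of \<open>LLPO\<close> has at most one nonzero entry.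
\<close>

definition refutation :: "baire \<Rightarrow> nat \<Rightarrow> nat \<Rightarrow> nat" where
  "refutation p v m = (let n = m div 2; b = m mod 2 in
    of_bool (dead p (2 * v + b) n \<and> \<not> dead p (2 * v + (1 - b)) n \<and>
      (\<forall>n'<n. \<not> dead p (2 * v + b) n')))"

definition tree_questions :: "baire \<Rightarrow> baire" where
  "tree_questions p x = refutation p (Suc (fst (prod_decode x))) (snd (prod_decode x))"

text \<open>
  The walk from the root that follows the answers \<open>q\<close>, by index in the enumeration rather than
  by number: the children of the word with index \<open>i\<close> have the indices \<open>2 * i + 1\<close> and
  \<open>2 * i + 2\<close>. The tree itself is not consulted.
\<close>

fun path_index :: "baire \<Rightarrow> nat \<Rightarrow> nat" where
  "path_index q 0 = 0"
| "path_index q (Suc m) = Suc (2 * path_index q m + q (path_index q m))"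

text \<open>
  A descendant \<open>n + 1\<close> levels below \<open>v\<close> is \<open>n\<close> levels below the left or the right child
  of \<open>v\<close>, according to whether its offset is less than \<open>2 ^ n\<close>.
\<close>

lemma dead_children: "dead p v (Suc n) \<longleftrightarrow> dead p (2 * v) n \<and> dead p (2 * v + 1) n"
proof (intro iffI conjI)
  assume d: "dead p v (Suc n)"
  have idx: "p (v * 2 ^ Suc n + j - 1) = 0" if "j < 2 ^ Suc n" for j
    using d that unfolding dead_def by blast
  show "dead p (2 * v) n" unfolding dead_def
  proof (intro allI impI)
    fix j :: nat assume "j < 2 ^ n"
    with idx[of j] show "p (2 * v * 2 ^ n + j - 1) = 0" by (simp add: mult_ac)
  qed
  show "dead p (2 * v + 1) n" unfolding dead_def
  proof (intro allI impI)
    fix j :: nat assume "j < 2 ^ n"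
    with idx[of "2 ^ n + j"] show "p ((2 * v + 1) * 2 ^ n + j - 1) = 0"
      by (simp add: algebra_simps)
  qed
next
  assume d: "dead p (2 * v) n \<and> dead p (2 * v + 1) n"
  show "dead p v (Suc n)" unfolding dead_def
  proof (intro allI impI)
    fix j :: nat assume j: "j < 2 ^ Suc n"
    show "p (v * 2 ^ Suc n + j - 1) = 0"
    proof (cases "j < 2 ^ n")
      case True
      then have "p (2 * v * 2 ^ n + j - 1) = 0" using d unfolding dead_def by blast
      moreover have "2 * v * 2 ^ n = v * 2 ^ Suc n" by simp
      ultimately show ?thesis by (simp only:)
    next
      case False
      then have "j - 2 ^ n < 2 ^ n" using j by simp
      then have "p ((2 * v + 1) * 2 ^ n + (j - 2 ^ n) - 1) = 0"
        using d unfolding dead_def by blast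
      moreover have "(2 * v + 1) * 2 ^ n + (j - 2 ^ n) = v * 2 ^ Suc n + j"
        using False by (simp add: algebra_simps)
      ultimately show ?thesis by (simp only:)
    qed
  qed
qed

context
  fixes p :: baire and T :: "nat list set"
  assumes tree: "binary_tree T" and p: "\<And>n. p n = of_bool (word n \<in> T)"
begin

text \<open>
  Every descendant at level \<open>n + 1\<close> has its parent at level \<open>n\<close>, and trees are closed under
  prefixes. For \<open>v = 0\<close> the numbering breaks down, because \<open>v * 2 ^ n + j - 1\<close> is truncated.
\<close>

lemma dead_Suc:
  assumes "0 < v" "dead p v n"
  shows "dead p v (Suc n)"
  unfolding dead_def
proof (intro allI impI)
  fix j :: nat assume j: "j < 2 ^ Suc n"
  define i where "i = v * 2 ^ n + j div 2 - 1"
  define b where "b = j mod 2"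
  have "v * 2 ^ n > 0" using assms by simp
  moreover have "2 * (j div 2) + b = j" by (simp add: b_def)
  moreover have "v * 2 ^ Suc n = 2 * (v * 2 ^ n)" by simp
  ultimately have "v * 2 ^ Suc n + j - 1 = Suc (2 * i + b)" unfolding i_def by linarith
  moreover have "b < 2" by (simp add: b_def)
  ultimately have "word (v * 2 ^ Suc n + j - 1) = word i @ [b]" by simp
  moreover have "j div 2 < 2 ^ n" using j by (simp add: less_mult_imp_div_less mult.commute)
  then have "p i = 0" using assms(2) unfolding dead_def i_def by blast
  then have "word i \<notin> T" by (simp add: p)
  ultimately have "word (v * 2 ^ Suc n + j - 1) \<notin> T"
    using tree unfolding binary_tree_def by (metis prefixI)
  then show "p (v * 2 ^ Suc n + j - 1) = 0" by (simp add: p)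
qed

lemma dead_mono:
  assumes "0 < v" "dead p v n" "n \<le> n'"
  shows "dead p v n'"
  using assms(3) by (induction n' rule: dec_induct) (simp_all add: assms dead_Suc)

text \<open>
  If both siblings were refuted, at levels \<open>n\<close> and \<open>n'\<close>, each would be dead at a level at which
  the other is still alive; as death is permanent, \<open>n < n'\<close> and \<open>n' < n\<close>.
\<close>

lemma refutation_unique:
  assumes v: "0 < v" and m: "refutation p v m \<noteq> 0" and m': "refutation p v m' \<noteq> 0"
  shows "m = m'"
proof -
  define n b n' b' where nb: "n = m div 2" "b = m mod 2" "n' = m' div 2" "b' = m' mod 2"
  from m have r: "dead p (2 * v + b) n" "\<not> dead p (2 * v + (1 - b)) n"
      "\<And>k. k < n \<Longrightarrow> \<not> dead p (2 * v + b) k"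
    unfolding refutation_def Let_def nb by auto
  from m' have r': "dead p (2 * v + b') n'" "\<not> dead p (2 * v + (1 - b')) n'"
      "\<And>k. k < n' \<Longrightarrow> \<not> dead p (2 * v + b') k"
    unfolding refutation_def Let_def nb by auto
  have "b < 2" "b' < 2" by (simp_all add: nb)
  have eq: "b = b'"
  proof (rule ccontr)
    assume "b \<noteq> b'"
    with \<open>b < 2\<close> \<open>b' < 2\<close> have "1 - b = b'" "1 - b' = b" by auto
    with r(2) r'(2) have "\<not> dead p (2 * v + b') n" "\<not> dead p (2 * v + b) n'" by metis+
    with r(1) r'(1) dead_mono[of "2 * v + b" n n'] dead_mono[of "2 * v + b'" n' n] v
    show False by (cases "n \<le> n'") auto
  qed
  with r r' have "n = n'" by (metis linorder_neqE_nat)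
  with eq show ?thesis by (metis nb div_mult_mod_eq)
qed

lemma tree_questions_mdom: "tree_questions p \<in> mdom (parallelization LLPO)"
  unfolding mdom_parallelization mdom_LLPO tree_questions_def by (auto intro: refutation_unique)

text \<open>
  If the answer \<open>b\<close> led to a finite subtree, then at the first level at which it is dead the
  sibling would have to be alive, because \<open>v\<close> itself never dies; so \<open>b\<close> would have been refuted.
\<close>

lemma child_infinite:
  assumes v: "0 < v" and inf: "\<And>n. \<not> dead p v n"
    and b: "b < 2" and ans: "\<And>n. refutation p v (2 * n + b) = 0"
  shows "\<not> dead p (2 * v + b) n"
proof
  assume "dead p (2 * v + b) n"
  then obtain n where n: "dead p (2 * v + b) n" "\<And>n'. n' < n \<Longrightarrow> \<not> dead p (2 * v + b) n'"
    by (metis exists_least_iff)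
  have "\<not> dead p (2 * v + (1 - b)) n"
    using inf[of "Suc n"] n(1) b unfolding dead_children by (cases "b = 0") (auto simp: less_2_cases_iff)
  with n ans[of n] b show False unfolding refutation_def Let_def by simp
qed

lemma not_dead_root:
  assumes "T \<in> mdom WKL"
  shows "\<not> dead p 1 n"
proof -
  from assms obtain q where q: "map q [0..<n] \<in> T"
    unfolding mdom_def WKL_def paths_def by blast
  with tree obtain i where i: "word i = map q [0..<n]"
    using bij_betw_word unfolding binary_tree_def bij_betw_def by (metis imageE subsetD)
  then have "2 ^ n \<le> Suc i" "Suc i < 2 ^ Suc n" using length_word_bounds[of i] by simp_all
  then have "Suc i - 2 ^ n < 2 ^ n" "1 * 2 ^ n + (Suc i - 2 ^ n) - 1 = i" by simp_all
  moreover have "p i \<noteq> 0" using q i by (simp add: p)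
  ultimately show ?thesis unfolding dead_def by metis
qed

lemma answers_give_path:
  assumes "T \<in> mdom WKL" and q: "q \<in> parallelization LLPO (tree_questions p)"
  shows "(\<lambda>m. q (path_index q m)) \<in> paths T"
proof -
  have q: "q k < 2 \<and> (\<forall>n. refutation p (Suc k) (2 * n + q k) = 0)" for k
  proof -
    from q have "q k \<in> LLPO (refutation p (Suc k))"
      unfolding parallelization_def tree_questions_def by simp
    then show ?thesis unfolding LLPO_def by (auto split: if_splits)
  qed
  have alive: "\<not> dead p (Suc (path_index q m)) n" for m n
  proof (induction m arbitrary: n)
    case 0
    then show ?case using not_dead_root[OF assms(1)] by simp
  next
    case (Suc m)
    from child_infinite[OF _ Suc.IH, of "q (path_index q m)"] q
    show ?case by simp
  qed
  have "word (path_index q m) = map (\<lambda>m. q (path_index q m)) [0..<m]" for m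
    using q by (induction m) simp_all
  moreover have "word (path_index q m) \<in> T" for m
    using alive[of m 0] by (simp add: dead_def p)
  moreover have "q k \<in> {0, 1}" for k using q[of k] by (auto simp: less_2_cases_iff)
  then have "range (\<lambda>m. q (path_index q m)) \<subseteq> {0, 1}" by (intro image_subsetI)
  ultimately show ?thesis unfolding paths_def by simp
qed

end

lemma computable_tree_questions: "computable (\<lambda>p. Some (tree_questions p))"
proof (rule computable_if_total_recursive)
  have dead: "total_recursive n (\<lambda>p xs. of_bool (dead p (f p xs) (g p xs)))"
    if "total_recursive n f" "total_recursive n g" for n f g
    unfolding dead_def by (intro total_recursive_intros total_recursive_weaken that) simp
  show "total_recursive 1 (\<lambda>p xs. tree_questions p (xs ! 0))"
    unfolding tree_questions_def refutation_def Let_def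
    by (intro total_recursive_intros total_recursive_div2 total_recursive_mod2
      total_recursive_prod_decode dead) simp_all
qed

lemma computable_path: "computable (\<lambda>q. Some (\<lambda>m. q (path_index q m)))"
proof (rule computable_if_total_recursive)
  have eq: "rec_nat 0 (\<lambda>_ r. Suc (2 * r + q r)) m = path_index q m" for q m
    by (induction m) simp_all
  have "total_recursive 1 (\<lambda>q xs. q (rec_nat 0 (\<lambda>_ r. Suc (2 * r + q r)) (xs ! 0)))"
    by (intro total_recursive_intros total_recursive_rec_nat) simp_all
  then show "total_recursive 1 (\<lambda>q xs. q (path_index q (xs ! 0)))"
    unfolding eq .
qed

lemma WKL_reducible_LLPO:
  "sW_reducible delta_Tr delta_Cantor WKL delta_Baire delta_Baire (parallelization LLPO)"
  unfolding sW_reducible_def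
proof (intro exI conjI allI impI)
  show "computable (\<lambda>q. Some (\<lambda>m. q (path_index q m)))" by (rule computable_path)
  show "computable (\<lambda>p. Some (tree_questions p))" by (rule computable_tree_questions)
  fix G assume G: "realizer delta_Baire delta_Baire (parallelization LLPO) G"
  show "realizer delta_Tr delta_Cantor WKL
      ((\<lambda>q. Some (\<lambda>m. q (path_index q m))) \<circ>\<^sub>m G \<circ>\<^sub>m (\<lambda>p. Some (tree_questions p)))"
    unfolding realizer_def
  proof (intro allI impI)
    fix p T assume pT: "delta_Tr p = Some T \<and> T \<in> mdom WKL"
    then have T: "binary_tree T" "\<And>n. p n = of_bool (word n \<in> T)"
      unfolding delta_Tr_eq_Some_iff by simp_all
    from tree_questions_mdom[OF T] G obtain q
      where q: "G (tree_questions p) = Some q" "q \<in> parallelization LLPO (tree_questions p)"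
      unfolding realizer_def delta_Baire_def by auto
    have path: "(\<lambda>m. q (path_index q m)) \<in> paths T"
      using answers_give_path[OF T] pT q(2) by blast
    then have "delta_Cantor (\<lambda>m. q (path_index q m)) = Some (\<lambda>m. q (path_index q m))"
      unfolding delta_Cantor_def paths_def by simp
    with path q(1) show "\<exists>r y. ((\<lambda>q. Some (\<lambda>m. q (path_index q m))) \<circ>\<^sub>m G \<circ>\<^sub>m
        (\<lambda>p. Some (tree_questions p))) p = Some r \<and> delta_Cantor r = Some y \<and> y \<in> WKL T"
      by (simp add: map_comp_def WKL_def)
  qed
qed


section \<open>From instances of LLPO to trees\<close>

definition answer_tree :: "baire \<Rightarrow> nat list set" where
  "answer_tree p = {w \<in> lists {0, 1}.
    \<forall>k<length w. \<forall>n<length w. p (prod_encode (k, 2 * n + w ! k)) = 0}"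

lemma binary_tree_answer_tree: "binary_tree (answer_tree p)"
proof -
  have "v \<in> answer_tree p" if "v @ u \<in> answer_tree p" for v u
  proof -
    have "p (prod_encode (k, 2 * n + v ! k)) = 0" if "k < length v" "n < length v" for k n
    proof -
      from that have "p (prod_encode (k, 2 * n + (v @ u) ! k)) = 0"
        using \<open>v @ u \<in> answer_tree p\<close> unfolding answer_tree_def by simp
      with that show ?thesis by (simp add: nth_append)
    qed
    moreover have "v \<in> lists {0, 1}" using that unfolding answer_tree_def by simp
    ultimately show ?thesis unfolding answer_tree_def by blast
  qed
  moreover have "answer_tree p \<subseteq> lists {0, 1}" unfolding answer_tree_def by blast
  ultimately show ?thesis unfolding binary_tree_def prefix_def by blast
qed

text \<open>
  The words in the tree test finitely many entries of each instance, but a path passes all of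
  these tests: entry \<open>n\<close> of instance \<open>k\<close> is tested by every prefix longer than \<open>k\<close> and \<open>n\<close>.
\<close>

lemma paths_answer_tree:
  assumes "p \<in> mdom (parallelization LLPO)"
  shows "paths (answer_tree p) = parallelization LLPO p"
proof -
  have LLPO: "LLPO (\<lambda>n. p (prod_encode (k, n))) =
      {i. i \<in> {0, 1} \<and> (\<forall>n. p (prod_encode (k, 2 * n + i)) = 0)}" for k
    using assms unfolding mdom_parallelization mdom_LLPO LLPO_def by auto
  have "(\<forall>l. map q [0..<l] \<in> answer_tree p) \<longleftrightarrow> (\<forall>k n. p (prod_encode (k, 2 * n + q k)) = 0)"
    if "range q \<subseteq> {0, 1}" for q
  proof
    assume q: "\<forall>l. map q [0..<l] \<in> answer_tree p"
    show "\<forall>k n. p (prod_encode (k, 2 * n + q k)) = 0"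
    proof (intro allI)
      fix k n
      let ?w = "map q [0..<Suc (max k n)]"
      from q have "?w \<in> answer_tree p" by blast
      moreover have "k < length ?w" "n < length ?w" by simp_all
      ultimately have "p (prod_encode (k, 2 * n + ?w ! k)) = 0"
        unfolding answer_tree_def by blast
      moreover have "?w ! k = q k" using \<open>k < length ?w\<close> by (simp del: upt_Suc)
      ultimately show "p (prod_encode (k, 2 * n + q k)) = 0" by simp
    qed
  next
    assume "\<forall>k n. p (prod_encode (k, 2 * n + q k)) = 0"
    moreover have "q k \<in> {0, 1}" for k using that rangeI[of q k] by blast
    ultimately show "\<forall>l. map q [0..<l] \<in> answer_tree p" by (simp add: answer_tree_def in_lists_conv_set)
  qed
  then have "paths (answer_tree p) =
      {q. range q \<subseteq> {0, 1} \<and> (\<forall>k n. p (prod_encode (k, 2 * n + q k)) = 0)}"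
    unfolding paths_def by (intro Collect_cong conj_cong refl)
  moreover have "range q \<subseteq> {0, 1} \<longleftrightarrow> (\<forall>k. q k \<in> {0, 1})" for q :: baire
    by (simp only: image_subset_iff ball_UNIV)
  ultimately show ?thesis unfolding parallelization_def LLPO by (simp add: all_conj_distrib)
qed

lemma computable_answer_tree: "computable (\<lambda>p. Some (\<lambda>i. of_bool (word i \<in> answer_tree p)))"
proof (rule computable_if_total_recursive, rule total_recursive_cong)
  show "total_recursive 1 (\<lambda>p xs. of_bool
      (\<forall>k<length (word (xs ! 0)). \<forall>n<length (word (xs ! 0)).
        p (prod_encode (k, 2 * n + Suc (xs ! 0) div 2 ^ (length (word (xs ! 0)) - Suc k) mod 2)) = 0))"
    by (intro total_recursive_intros total_recursive_mod2 total_recursive_div_power2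
      total_recursive_prod_encode total_recursive_length_word) simp_all
  have "word i \<in> lists {0, 1}" for i using bij_betw_word unfolding bij_betw_def by blast
  then show "of_bool (\<forall>k<length (word (xs ! 0)). \<forall>n<length (word (xs ! 0)).
      p (prod_encode (k, 2 * n + Suc (xs ! 0) div 2 ^ (length (word (xs ! 0)) - Suc k) mod 2)) = 0) =
      of_bool (word (xs ! 0) \<in> answer_tree p)" for p xs
    unfolding answer_tree_def by (simp add: nth_word)
qed

lemma LLPO_reducible_WKL:
  "sW_reducible delta_Baire delta_Baire (parallelization LLPO) delta_Tr delta_Cantor WKL"
  unfolding sW_reducible_def
proof (intro exI conjI allI impI)
  show "computable (\<lambda>q. Some (\<lambda>m. q m))"
    by (intro computable_if_total_recursive total_recursive_basic) simp
  show "computable (\<lambda>p. Some (\<lambda>i. of_bool (word i \<in> answer_tree p)))"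
    by (rule computable_answer_tree)
  fix G assume G: "realizer delta_Tr delta_Cantor WKL G"
  show "realizer delta_Baire delta_Baire (parallelization LLPO)
      ((\<lambda>q. Some (\<lambda>m. q m)) \<circ>\<^sub>m G \<circ>\<^sub>m (\<lambda>p. Some (\<lambda>i. of_bool (word i \<in> answer_tree p))))"
    unfolding realizer_def
  proof (intro allI impI)
    fix p x assume "delta_Baire p = Some x \<and> x \<in> mdom (parallelization LLPO)"
    then have x: "x = p" and p: "p \<in> mdom (parallelization LLPO)"
      by (simp_all add: delta_Baire_def)
    let ?t = "\<lambda>i. of_bool (word i \<in> answer_tree p)"
    have "delta_Tr ?t = Some (answer_tree p)"
      unfolding delta_Tr_eq_Some_iff using binary_tree_answer_tree by simp
    moreover have "answer_tree p \<in> mdom WKL"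
      using p by (simp add: mdom_def WKL_def paths_answer_tree[OF p])
    ultimately obtain q y where q: "G ?t = Some q" "delta_Cantor q = Some y"
        "y \<in> WKL (answer_tree p)"
      using G unfolding realizer_def by blast
    then have "y = q" by (simp add: delta_Cantor_def split: if_splits)
    with q have "q \<in> parallelization LLPO p" by (simp add: WKL_def paths_answer_tree[OF p])
    with q(1) show "\<exists>q y. ((\<lambda>q. Some (\<lambda>m. q m)) \<circ>\<^sub>m G \<circ>\<^sub>m
        (\<lambda>p. Some (\<lambda>i. of_bool (word i \<in> answer_tree p)))) p = Some q \<and>
        delta_Baire q = Some y \<and> y \<in> parallelization LLPO x"
      by (simp add: map_comp_def delta_Baire_def x)
  qed
qed

theorem theorem8p2:
  "sW_equivalent delta_Tr delta_Cantor WKL delta_Baire delta_Baire (parallelization LLPO)"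
  unfolding sW_equivalent_def using WKL_reducible_LLPO LLPO_reducible_WKL by blast

end
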